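(* Let $h=1/N$, let $V_i\in\mathbb{R}$ ($i=0,\dots,N-1$) be given, and use periodic indexing modulo $N$. Let the jump rates be given by the detailed-balance parametrization $$F_{i+\frac12}=\frac{1}{h^2}\gamma_{i+\frac12}e^{V_i},\qquad B_{i+\frac12}=\frac{1}{h^2}\gamma_{i+\frac12}e^{V_{i+1}},$$ with a nonnegative edge coefficient $\gamma_{i+\frac12}$ (possibly depending on $\bm\rho$). This includes the exact coefficient $\gamma^{\rm exact}_{i+\frac12}(\bm\rho)$ and each of the reconstructed coefficients $\gamma^{\rm rec}_{i+\frac12}$, ${\rm rec}\in\{\mathrm{ED},\mathrm{SG/WPE},\mathrm{IWPE},\mathrm{AM},\mathrm{LM}\}$. If $\rho_i(t)>0$ for all $i$ and $\bm\rho(t)$ solves $$\frac{\mathrm{d}\rho_i}{\mathrm{d}t}=F_{i-\frac12}\rho_{i-1}-B_{i-\frac12}\rho_i-F_{i+\frac12}\rho_i+B_{i+\frac12}\rho_{i+1},\qquad i=0,\dots,N-1,$$ then $$\frac{\mathrm{d}}{\mathrm{d}t}\mathcal{F}_h[\bm\rho(t)]=-\triangle_h^{\rm ME}[\bm\rho(t)]\le 0,$$ where, with $\mu_i=\ln\rho_i+V_i$, $$\triangle_h^{\rm ME}[\bm\rho]:=h\sum_{i=0}^{N-1}\gamma_{i+\frac12}\,\frac{e^{\mu_{i+1}}-e^{\mu_i}}{h}\,\frac{\mu_{i+1}-\mu_i}{h}\ \ge 0.$$ Moreover, for the exact coefficient $\gamma_{i+\frac12}=\gamma^{\rm exact}_{i+\frac12}(\bm\rho)$,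 $$\triangle_h^{\rm ME}[\bm\rho]=\triangle_h[\bm\rho].$$
   Context: Discrete free energy: $\mathcal{F}_h[\bm\rho]=h\sum_{i=0}^{N-1}\bigl(\rho_i\ln\rho_i-\rho_i+\rho_iV_i\bigr)$. Finite-difference dissipation: $\triangle_h[\bm\rho]=h\sum_{i=0}^{N-1}\widehat\rho_{i+\frac12}\left|\frac{\mu_{i+1}-\mu_i}{h}\right|^2$, where $\widehat\rho_{i+\frac12}\ge 0$ is an interface density reconstructed from $\bm\rho$. Exact coefficient: $\gamma^{\rm exact}_{i+\frac12}(\bm\rho)=\widehat\rho_{i+\frac12}\,\dfrac{\mu_{i+1}-\mu_i}{e^{\mu_{i+1}}-e^{\mu_i}}$, understood by continuity as $\widehat\rho_{i+\frac12}e^{-\mu_i}$ when $\mu_{i+1}=\mu_i$. Reconstructed coefficients, with logarithmic mean $L(a,b)=\frac{b-a}{\ln b-\ln a}$ for $a\ne b$, $L(a,a)=a$: $\gamma^{\rm ED}_{i+\frac12}=\sqrt{e^{-V_i}e^{-V_{i+1}}}$; $\gamma^{\rm SG/WPE}_{i+\frac12}=1/L(e^{V_i},e^{V_{i+1}})$; $\gamma^{\rm IWPE}_{i+\frac12}=\frac{2}{e^{V_i}+e^{V_{i+1}}}$; $\gamma^{\rm AM}_{i+\frac12}=\frac{e^{-V_i}+e^{-V_{i+1}}}{2}$; $\gamma^{\rm LM}_{i+\frac12}=L(e^{-V_i},e^{-V_{i+1}})$. *)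

theory Defs
  imports "HOL-Analysis.Analysis"
begin

text \<open>
  A grid function is a map \<open>nat \<Rightarrow> real\<close> of which only the values at the nodes \<open>i < N\<close> matter.
  Indices are periodic modulo \<open>N\<close>. Edge quantities are indexed by the left node: index \<open>i\<close>
  stands for the interface \<open>i + 1/2\<close>, hence \<open>prv N i\<close> for the interface \<open>i - 1/2\<close>.
\<close>

definition nxt :: "nat \<Rightarrow> nat \<Rightarrow> nat" where
  "nxt N i = (i + 1) mod N"

text \<open>Adding \<open>N\<close> first keeps the truncated subtraction on \<open>nat\<close> from cutting off at \<open>i = 0\<close>.\<close>

definition prv :: "nat \<Rightarrow> nat \<Rightarrow> nat" where
  "prv N i = (i + N - 1) mod N"

definition mesh :: "nat \<Rightarrow> real" where
  "mesh N = 1 / real N"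

definition positive_state :: "nat \<Rightarrow> (nat \<Rightarrow> real) \<Rightarrow> bool" where
  "positive_state N \<rho> \<longleftrightarrow> (\<forall>i<N. \<rho> i > 0)"

text \<open>
  State-dependent edge quantities, nonnegative at every positive state; used both for the edge
  coefficients and for the reconstructed interface densities.
\<close>

definition nonneg_edge :: "nat \<Rightarrow> ((nat \<Rightarrow> real) \<Rightarrow> nat \<Rightarrow> real) \<Rightarrow> bool" where
  "nonneg_edge N \<gamma> \<longleftrightarrow> (\<forall>\<rho>. positive_state N \<rho> \<longrightarrow> (\<forall>i<N. \<gamma> \<rho> i \<ge> 0))"

definition chem_pot :: "(nat \<Rightarrow> real) \<Rightarrow> (nat \<Rightarrow> real) \<Rightarrow> nat \<Rightarrow> real" where
  "chem_pot V \<rho> i = ln (\<rho> i) + V i"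

definition free_energy :: "nat \<Rightarrow> (nat \<Rightarrow> real) \<Rightarrow> (nat \<Rightarrow> real) \<Rightarrow> real" where
  "free_energy N V \<rho> = mesh N * (\<Sum>i<N. \<rho> i * ln (\<rho> i) - \<rho> i + \<rho> i * V i)"

definition fd_dissipation ::
    "nat \<Rightarrow> (nat \<Rightarrow> real) \<Rightarrow> ((nat \<Rightarrow> real) \<Rightarrow> nat \<Rightarrow> real) \<Rightarrow> (nat \<Rightarrow> real) \<Rightarrow> real" where
  "fd_dissipation N V \<rho>hat \<rho> =
     mesh N * (\<Sum>i<N. \<rho>hat \<rho> i * \<bar>(chem_pot V \<rho> (nxt N i) - chem_pot V \<rho> i) / mesh N\<bar>\<^sup>2)"

definition me_dissipation ::
    "nat \<Rightarrow> (nat \<Rightarrow> real) \<Rightarrow> ((nat \<Rightarrow> real) \<Rightarrow> nat \<Rightarrow> real) \<Rightarrow> (nat \<Rightarrow> real) \<Rightarrow> real" where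
  "me_dissipation N V \<gamma> \<rho> =
     mesh N * (\<Sum>i<N. \<gamma> \<rho> i
       * ((exp (chem_pot V \<rho> (nxt N i)) - exp (chem_pot V \<rho> i)) / mesh N)
       * ((chem_pot V \<rho> (nxt N i) - chem_pot V \<rho> i) / mesh N))"

definition fwd_rate ::
    "nat \<Rightarrow> (nat \<Rightarrow> real) \<Rightarrow> ((nat \<Rightarrow> real) \<Rightarrow> nat \<Rightarrow> real) \<Rightarrow> (nat \<Rightarrow> real) \<Rightarrow> nat \<Rightarrow> real" where
  "fwd_rate N V \<gamma> \<rho> i = 1 / (mesh N)\<^sup>2 * \<gamma> \<rho> i * exp (V i)"

definition bwd_rate ::
    "nat \<Rightarrow> (nat \<Rightarrow> real) \<Rightarrow> ((nat \<Rightarrow> real) \<Rightarrow> nat \<Rightarrow> real) \<Rightarrow> (nat \<Rightarrow> real) \<Rightarrow> nat \<Rightarrow> real" where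
  "bwd_rate N V \<gamma> \<rho> i = 1 / (mesh N)\<^sup>2 * \<gamma> \<rho> i * exp (V (nxt N i))"

definition master_rhs ::
    "nat \<Rightarrow> (nat \<Rightarrow> real) \<Rightarrow> ((nat \<Rightarrow> real) \<Rightarrow> nat \<Rightarrow> real) \<Rightarrow> (nat \<Rightarrow> real) \<Rightarrow> nat \<Rightarrow> real" where
  "master_rhs N V \<gamma> \<rho> i =
     fwd_rate N V \<gamma> \<rho> (prv N i) * \<rho> (prv N i)
     - bwd_rate N V \<gamma> \<rho> (prv N i) * \<rho> i
     - fwd_rate N V \<gamma> \<rho> i * \<rho> i
     + bwd_rate N V \<gamma> \<rho> i * \<rho> (nxt N i)"

text \<open>
  The derivative is taken relative to the time interval \<open>T\<close>, so that it is one-sided at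
  endpoints belonging to \<open>T\<close> and the ordinary derivative at interior points.
\<close>

definition solves_master ::
    "nat \<Rightarrow> (nat \<Rightarrow> real) \<Rightarrow> ((nat \<Rightarrow> real) \<Rightarrow> nat \<Rightarrow> real) \<Rightarrow> real set \<Rightarrow> (real \<Rightarrow> nat \<Rightarrow> real) \<Rightarrow> bool" where
  "solves_master N V \<gamma> T \<rho> \<longleftrightarrow>
     (\<forall>t\<in>T. \<forall>i<N. ((\<lambda>s. \<rho> s i) has_real_derivative master_rhs N V \<gamma> (\<rho> t) i) (at t within T))"

definition gamma_exact ::
    "nat \<Rightarrow> (nat \<Rightarrow> real) \<Rightarrow> ((nat \<Rightarrow> real) \<Rightarrow> nat \<Rightarrow> real) \<Rightarrow> (nat \<Rightarrow> real) \<Rightarrow> nat \<Rightarrow> real" where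
  "gamma_exact N V \<rho>hat \<rho> i =
     (let m = chem_pot V \<rho> i; m' = chem_pot V \<rho> (nxt N i)
      in if m' = m then \<rho>hat \<rho> i * exp (- m)
         else \<rho>hat \<rho> i * ((m' - m) / (exp m' - exp m)))"

definition log_mean :: "real \<Rightarrow> real \<Rightarrow> real" where
  "log_mean a b = (if a = b then a else (b - a) / (ln b - ln a))"

datatype recon = ED | SG_WPE | IWPE | AM | LM

fun gamma_rec :: "recon \<Rightarrow> nat \<Rightarrow> (nat \<Rightarrow> real) \<Rightarrow> nat \<Rightarrow> real" where
  "gamma_rec ED N V i = sqrt (exp (- V i) * exp (- V (nxt N i)))"
| "gamma_rec SG_WPE N V i = 1 / log_mean (exp (V i)) (exp (V (nxt N i)))"
| "gamma_rec IWPE N V i = 2 / (exp (V i) + exp (V (nxt N i)))"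
| "gamma_rec AM N V i = (exp (- V i) + exp (- V (nxt N i))) / 2"
| "gamma_rec LM N V i = log_mean (exp (- V i)) (exp (- V (nxt N i)))"

end

theory Submission
  imports Defs
begin

text \<open>
  The energy law is summation by parts on a cycle. The chemical potential is the gradient of the
  free energy, since the derivative of \<open>x ln x - x + x v\<close> is \<open>ln x + v\<close>, and detailed balance
  makes the net flux across an edge equal to \<open>-\<gamma>/h\<^sup>2\<close> times the jump of \<open>exp \<mu>\<close>
  (\<open>edge_flux_eq\<close>). The master equation is the discrete continuity equation for this flux
  (\<open>master_rhs_eq_flux_difference\<close>), so pairing it with \<open>\<mu>\<close> and shifting the index around the
  cycle (\<open>periodic_summation_by_parts\<close>) moves the difference from the flux onto \<open>\<mu>\<close>, which
  leaves exactly the dissipation with a minus sign (\<open>sum_chem_pot_master_rhs\<close>).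

  The dissipation is nonnegative edge by edge: \<open>exp\<close> is increasing, so the jumps of \<open>exp \<mu>\<close>
  and of \<open>\<mu>\<close> have the same sign. Nonnegativity of the exact coefficient and of the reconstructed
  coefficients that use the logarithmic mean comes from the same monotonicity (of \<open>exp\<close> or of
  \<open>ln\<close>). Finally, the exact coefficient is the divided difference chosen so that its product
  with the jump of \<open>exp \<mu>\<close> is \<open>\<rho>hat\<close> times the jump of \<open>\<mu>\<close> (\<open>gamma_exact_mult_exp_diff\<close>); inserting
  this in the dissipation edge by edge yields the square of the finite difference.
\<close>

lemma nxt_less: "i < N \<Longrightarrow> nxt N i < N"
  by (simp add: nxt_def)

lemma prv_less: "i < N \<Longrightarrow> prv N i < N"
  by (simp add: prv_def)

lemma nxt_prv: "i < N \<Longrightarrow> nxt N (prv N i) = i"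
  by (simp add: nxt_def prv_def mod_simps)

lemma prv_nxt:
  assumes "i < N"
  shows "prv N (nxt N i) = i"
proof (cases "i + 1 = N")
  case True
  then show ?thesis by (auto simp: nxt_def prv_def)
next
  case False
  with assms show ?thesis by (simp add: nxt_def prv_def)
qed

lemma bij_betw_nxt: "bij_betw (nxt N) {..<N} {..<N}"
  by (rule bij_betw_byWitness[where f' = "prv N"]) (auto simp: nxt_less prv_less nxt_prv prv_nxt)

text \<open>On a cycle the shift by one node permutes the indices, so no boundary terms arise.\<close>

lemma periodic_summation_by_parts:
  fixes u J :: "nat \<Rightarrow> real"
  shows "(\<Sum>i<N. u i * (J (prv N i) - J i)) = (\<Sum>i<N. J i * (u (nxt N i) - u i))"
proof -
  have "(\<Sum>i<N. u i * J (prv N i)) = (\<Sum>i<N. u (nxt N i) * J (prv N (nxt N i)))"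
    by (rule sum.reindex_bij_betw[OF bij_betw_nxt, symmetric])
  also have "\<dots> = (\<Sum>i<N. u (nxt N i) * J i)"
    by (rule sum.cong) (simp_all add: prv_nxt)
  finally show ?thesis
    by (simp add: right_diff_distrib sum_subtractf mult.commute)
qed

definition edge_flux ::
    "nat \<Rightarrow> (nat \<Rightarrow> real) \<Rightarrow> ((nat \<Rightarrow> real) \<Rightarrow> nat \<Rightarrow> real) \<Rightarrow> (nat \<Rightarrow> real) \<Rightarrow> nat \<Rightarrow> real" where
  "edge_flux N V \<gamma> \<rho> i = fwd_rate N V \<gamma> \<rho> i * \<rho> i - bwd_rate N V \<gamma> \<rho> i * \<rho> (nxt N i)"

lemma exp_chem_pot: "\<rho> i > 0 \<Longrightarrow> exp (chem_pot V \<rho> i) = \<rho> i * exp (V i)"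
  by (simp add: chem_pot_def exp_add)

text \<open>
  Detailed balance: both rates share the coefficient \<open>\<gamma>\<close>, and the factor \<open>exp (V i)\<close> at each end
  is what turns the density there into \<open>exp \<mu>\<close>.
\<close>

lemma edge_flux_eq:
  assumes "positive_state N \<rho>" "i < N"
  shows "edge_flux N V \<gamma> \<rho> i
    = - (\<gamma> \<rho> i / (mesh N)\<^sup>2) * (exp (chem_pot V \<rho> (nxt N i)) - exp (chem_pot V \<rho> i))"
proof -
  have "\<rho> i > 0" "\<rho> (nxt N i) > 0"
    using assms nxt_less by (auto simp: positive_state_def)
  then show ?thesis
    by (simp add: edge_flux_def fwd_rate_def bwd_rate_def exp_chem_pot algebra_simps diff_divide_distrib)
qed

lemma master_rhs_eq_flux_difference:
  assumes "i < N"
  shows "master_rhs N V \<gamma> \<rho> i = edge_flux N V \<gamma> \<rho> (prv N i) - edge_flux N V \<gamma> \<rho> i"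
  using assms by (simp add: master_rhs_def edge_flux_def nxt_prv)

lemma sum_chem_pot_master_rhs:
  assumes "positive_state N \<rho>"
  shows "mesh N * (\<Sum>i<N. chem_pot V \<rho> i * master_rhs N V \<gamma> \<rho> i) = - me_dissipation N V \<gamma> \<rho>"
proof -
  let ?\<mu> = "chem_pot V \<rho>" and ?J = "edge_flux N V \<gamma> \<rho>"
  have "(\<Sum>i<N. ?\<mu> i * master_rhs N V \<gamma> \<rho> i) = (\<Sum>i<N. ?\<mu> i * (?J (prv N i) - ?J i))"
    by (rule sum.cong) (simp_all add: master_rhs_eq_flux_difference)
  also have "\<dots> = (\<Sum>i<N. ?J i * (?\<mu> (nxt N i) - ?\<mu> i))"
    by (rule periodic_summation_by_parts)
  also have "\<dots> = (\<Sum>i<N. - (\<gamma> \<rho> i * ((exp (?\<mu> (nxt N i)) - exp (?\<mu> i)) / mesh N)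
                             * ((?\<mu> (nxt N i) - ?\<mu> i) / mesh N)))"
    by (rule sum.cong) (simp_all add: edge_flux_eq[OF assms] power2_eq_square)
  finally show ?thesis
    by (simp add: me_dissipation_def sum_negf)
qed

lemma me_dissipation_nonneg:
  assumes "nonneg_edge N \<gamma>" "positive_state N \<rho>"
  shows "me_dissipation N V \<gamma> \<rho> \<ge> 0"
proof -
  have same_sign: "(exp b - exp a) / h * ((b - a) / h) \<ge> 0" for a b h :: real
    by (cases "a \<le> b") (auto simp: zero_le_mult_iff zero_le_divide_iff divide_le_0_iff)
  have "\<gamma> \<rho> i * ((exp b - exp a) / mesh N) * ((b - a) / mesh N) \<ge> 0" if "i < N" for i a b
    using mult_nonneg_nonneg[OF _ same_sign] assms that
    by (simp add: nonneg_edge_def mult.assoc)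
  then show ?thesis
    unfolding me_dissipation_def
    by (intro mult_nonneg_nonneg[of "mesh N"] sum_nonneg) (simp_all add: mesh_def)
qed

text \<open>
  The chain rule with \<open>\<mu>\<close> as the gradient of the free energy: in the derivative of \<open>x ln x - x\<close>,
  the term \<open>x \<cdot> 1/x\<close> cancels against the \<open>- 1\<close>.
\<close>

lemma free_energy_has_derivative:
  assumes pos: "positive_state N (\<rho> t)"
    and deriv: "\<And>i. i < N \<Longrightarrow> ((\<lambda>s. \<rho> s i) has_real_derivative D i) (at t within T)"
  shows "((\<lambda>s. free_energy N V (\<rho> s)) has_real_derivative
           mesh N * (\<Sum>i<N. chem_pot V (\<rho> t) i * D i)) (at t within T)"
  unfolding free_energy_def
proof (intro DERIV_cmult DERIV_sum)
  fix i assume "i \<in> {..<N}"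
  then have [simp]: "\<rho> t i > 0" and d: "((\<lambda>s. \<rho> s i) has_real_derivative D i) (at t within T)"
    using pos deriv by (auto simp: positive_state_def)
  have [simp]: "\<rho> t i \<noteq> 0"
    using \<open>\<rho> t i > 0\<close> by linarith
  show "((\<lambda>s. \<rho> s i * ln (\<rho> s i) - \<rho> s i + \<rho> s i * V i) has_real_derivative
           chem_pot V (\<rho> t) i * D i) (at t within T)"
    by (rule derivative_eq_intros d refl | simp add: chem_pot_def field_simps)+
qed

lemma gamma_exact_nonneg:
  assumes "nonneg_edge N \<rho>hat"
  shows "nonneg_edge N (gamma_exact N V \<rho>hat)"
proof -
  have "(b - a) / (exp b - exp a) \<ge> 0" for a b :: real
    by (cases "a \<le> b") (auto simp: zero_le_divide_iff)
  then show ?thesis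
    using assms by (auto simp: nonneg_edge_def gamma_exact_def Let_def simp del: times_divide_eq_right intro!: mult_nonneg_nonneg)
qed

text \<open>
  Clearing the denominator of the divided difference absorbs the case distinction: where \<open>\<mu>\<close> does
  not jump, both sides vanish.
\<close>

lemma gamma_exact_mult_exp_diff:
  "gamma_exact N V \<rho>hat \<rho> i * (exp (chem_pot V \<rho> (nxt N i)) - exp (chem_pot V \<rho> i))
     = \<rho>hat \<rho> i * (chem_pot V \<rho> (nxt N i) - chem_pot V \<rho> i)"
  by (simp add: gamma_exact_def Let_def)

lemma me_dissipation_gamma_exact:
  "me_dissipation N V (gamma_exact N V \<rho>hat) \<rho> = fd_dissipation N V \<rho>hat \<rho>"
proof -
  have "g * ((b' - a') / h) * ((b - a) / h) = r * \<bar>(b - a) / h\<bar>\<^sup>2"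
    if "g * (b' - a') = r * (b - a)" for g r a b a' b' h :: real
  proof -
    have "g * ((b' - a') / h) * ((b - a) / h) = g * (b' - a') * ((b - a) / (h * h))"
      by simp
    also have "\<dots> = r * \<bar>(b - a) / h\<bar>\<^sup>2"
      unfolding that by (simp add: power2_eq_square)
    finally show ?thesis .
  qed
  from this[OF gamma_exact_mult_exp_diff] show ?thesis
    by (simp add: me_dissipation_def fd_dissipation_def)
qed

lemma log_mean_nonneg:
  assumes "a > 0" "b > 0"
  shows "log_mean a b \<ge> 0"
  using assms by (cases "a \<le> b") (auto simp: log_mean_def zero_le_divide_iff)

lemma gamma_rec_nonneg: "gamma_rec r N V i \<ge> 0"
  by (cases r) (auto simp: log_mean_nonneg intro: add_nonneg_nonneg)

theorem proposition3p1:
  fixes N :: nat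
    and V :: "nat \<Rightarrow> real"
    and \<rho>hat :: "(nat \<Rightarrow> real) \<Rightarrow> nat \<Rightarrow> real"
  assumes "N \<ge> 1"
    and "nonneg_edge N \<rho>hat"
  shows "(\<forall>\<gamma>. nonneg_edge N \<gamma> \<longrightarrow>
            (\<forall>\<rho>. positive_state N \<rho> \<longrightarrow> me_dissipation N V \<gamma> \<rho> \<ge> 0)
          \<and> (\<forall>T \<rho>. is_interval T \<and> (\<forall>t\<in>T. positive_state N (\<rho> t)) \<and> solves_master N V \<gamma> T \<rho> \<longrightarrow>
               (\<forall>t\<in>T. ((\<lambda>s. free_energy N V (\<rho> s)) has_real_derivative
                          - me_dissipation N V \<gamma> (\<rho> t)) (at t within T)
                      \<and> - me_dissipation N V \<gamma> (\<rho> t) \<le> 0)))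
       \<and> nonneg_edge N (gamma_exact N V \<rho>hat)
       \<and> (\<forall>r. nonneg_edge N (\<lambda>_. gamma_rec r N V))
       \<and> (\<forall>\<rho>. positive_state N \<rho> \<longrightarrow>
            me_dissipation N V (gamma_exact N V \<rho>hat) \<rho> = fd_dissipation N V \<rho>hat \<rho>)"
proof (intro conjI allI impI ballI)
  show "me_dissipation N V \<gamma> \<rho> \<ge> 0" if "nonneg_edge N \<gamma>" "positive_state N \<rho>" for \<gamma> \<rho>
    using that by (rule me_dissipation_nonneg)
next
  fix \<gamma> T \<rho> t
  assume \<gamma>: "nonneg_edge N \<gamma>" and t: "t \<in> T"
    and sol: "is_interval T \<and> (\<forall>t\<in>T. positive_state N (\<rho> t)) \<and> solves_master N V \<gamma> T \<rho>"
  then have pos: "positive_state N (\<rho> t)"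
    by blast
  have "((\<lambda>s. \<rho> s i) has_real_derivative master_rhs N V \<gamma> (\<rho> t) i) (at t within T)" if "i < N" for i
    using sol t that by (simp add: solves_master_def)
  from free_energy_has_derivative[where V = V, OF pos this]
  show "((\<lambda>s. free_energy N V (\<rho> s)) has_real_derivative - me_dissipation N V \<gamma> (\<rho> t))
          (at t within T)"
    by (simp add: sum_chem_pot_master_rhs[OF pos])
  show "- me_dissipation N V \<gamma> (\<rho> t) \<le> 0"
    using me_dissipation_nonneg[OF \<gamma> pos] by simp
next
  show "nonneg_edge N (gamma_exact N V \<rho>hat)"
    using assms(2) by (rule gamma_exact_nonneg)
next
  show "nonneg_edge N (\<lambda>_. gamma_rec r N V)" for r
    by (simp add: nonneg_edge_def gamma_rec_nonneg)
next
  show "me_dissipation N V (gamma_exact N V \<rho>hat) \<rho> = fd_dissipation N V \<rho>hat \<rho>" for \<rho>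
    by (rule me_dissipation_gamma_exact)
qed

end
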